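(* Let $k$ be a finite field with $q$ elements, and let $m,n$ be integers with $0\le 2m\le n+1$. Then the characteristic function of $H_m$, as a function on $W_n$, equals $$\sum_{K\in\mathbf{P}_m}\chi_K\;-\;q\sum_{K\in\mathbf{P}_{m-1}}\chi_K,$$ where $\chi_K$ is the characteristic function of the set $K\subseteq W_n$, and the second sum is interpreted as zero when $m=0$.
   Context: For an integer $n\ge -1$, $V_n$ is the $k$-vector space of homogeneous polynomials of degree $n$ (including $0$) in $k[Y,Z]$, with $V_{-1}=\{0\}$; $W_n$ is the dual of $V_n$, identified with the space of sequences $x=(x_0,\ldots,x_n)\in k^{n+1}$ by letting $x$ act as $\sum_{i=0}^n a_iY^iZ^{n-i}\mapsto\sum_{i=0}^n a_ix_i$. For $d\ge 0$, $n+1\ge d$ and $Q\in V_d$, $M_n(Q):V_{n-d}\to V_n$ is the linear map $P\mapsto PQ$, and $M_n^*(Q):W_n\to W_{n-d}$ is its adjoint; explicitly, if $Q=\sum_{i=0}^d a_iY^iZ^{d-i}$, the $j$-th term of $M_n^*(Q)(x)$ is $\sum_{i=0}^d a_ix_{i+j}$ for $0\le j\le n-d$. $H_m\subseteq W_n$ is the set of sequences $(x_0,\ldots,x_n)$ for which there exist $a_0,\ldots,a_m\in k$, not all zero, such that $\sum_{i=0}^m a_ix_{i+j}=0$ for each $j=0,1,\ldots,n-m$. $\mathbf{P}_d$ is the set of all subspaces of $W_n$ of the form $\ker M_n^*(Q)$ for some nonzero $Q\in V_d$ (each subspace counted once). *)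

theory Defs
  imports
    "HOL-Computational_Algebra.Polynomial"
    "HOL-Library.Indicator_Function"
    "HOL-Library.Cardinality"
    "Jordan_Normal_Form.Matrix"
begin

text \<open>
  The ring \<open>k[Y, Z]\<close> is represented as \<open>k[Y][Z]\<close>, so \<open>coeff (coeff P j) i\<close> is the coefficient
  of \<open>Y\<^sup>i Z\<^sup>j\<close>. The degree \<open>n\<close> is an integer because \<open>n = -1\<close> is allowed; then \<open>homog n = {0}\<close>
  and \<open>seqs n\<close> consists of the empty sequence.
\<close>

definition homog :: "int \<Rightarrow> 'k::field poly poly set" where
  "homog n = {P. \<forall>i j. coeff (coeff P j) i \<noteq> 0 \<longrightarrow> int (i + j) = n}"

text \<open>The coefficient of \<open>Y\<^sup>i Z\<^sup>d\<^sup>-\<^sup>i\<close>, for \<open>i \<le> d\<close>.\<close>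

definition hcoeff :: "nat \<Rightarrow> 'k::field poly poly \<Rightarrow> nat \<Rightarrow> 'k" where
  "hcoeff d P i = coeff (coeff P (d - i)) i"

definition seqs :: "int \<Rightarrow> 'k::field vec set" where
  "seqs n = carrier_vec (nat (n + 1))"

text \<open>The identification of \<open>seqs n\<close> with the dual of \<open>homog n\<close>.\<close>

definition act :: "int \<Rightarrow> 'k::field vec \<Rightarrow> 'k poly poly \<Rightarrow> 'k" where
  "act n x P = (\<Sum>i<nat (n + 1). hcoeff (nat n) P i * x $ i)"

definition mult_adj :: "int \<Rightarrow> nat \<Rightarrow> 'k::field poly poly \<Rightarrow> 'k vec \<Rightarrow> 'k vec" where
  "mult_adj n d Q x =
     vec (nat (n - int d + 1)) (\<lambda>j. \<Sum>i\<le>d. hcoeff d Q i * x $ (i + j))"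

definition ker_adj :: "int \<Rightarrow> nat \<Rightarrow> 'k::field poly poly \<Rightarrow> 'k vec set" where
  "ker_adj n d Q = {x \<in> seqs n. mult_adj n d Q x = 0\<^sub>v (nat (n - int d + 1))}"

definition kernels :: "int \<Rightarrow> nat \<Rightarrow> 'k::field vec set set" where
  "kernels n d = {ker_adj n d Q | Q. Q \<in> homog (int d) \<and> Q \<noteq> 0}"

definition rec_seqs :: "int \<Rightarrow> nat \<Rightarrow> 'k::field vec set" where
  "rec_seqs n m = {x \<in> seqs n. \<exists>a :: nat \<Rightarrow> 'k. (\<exists>i\<le>m. a i \<noteq> 0) \<and>
     (\<forall>j::nat. int j \<le> n - int m \<longrightarrow> (\<Sum>i\<le>m. a i * x $ (i + j)) = 0)}"

lemma finite_kernels: "finite (kernels n d :: 'k::{field,finite} vec set set)"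
proof -
  have "finite (carrier_vec N :: 'k vec set)" for N
  proof -
    have "carrier_vec N \<subseteq> vec_of_list ` {xs :: 'k list. set xs \<subseteq> UNIV \<and> length xs = N}"
    proof
      fix v :: "'k vec" assume "v \<in> carrier_vec N"
      then show "v \<in> vec_of_list ` {xs. set xs \<subseteq> UNIV \<and> length xs = N}"
        by (intro image_eqI[of _ _ "list_of_vec v"]) (auto simp: vec_list)
    qed
    then show ?thesis
      by (rule finite_subset) (intro finite_imageI finite_lists_length_eq, simp)
  qed
  moreover have "kernels n d \<subseteq> Pow (seqs n :: 'k vec set)"
    by (auto simp: kernels_def ker_adj_def)
  ultimately show ?thesis
    unfolding seqs_def by (meson finite_Pow_iff finite_subset)
qed

lemma hcoeff_mult:
  fixes P Q :: "'k::field poly poly"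
  assumes P: "P \<in> homog (int e)" and Q: "Q \<in> homog (int d)" and l: "l \<le> e + d"
  shows "hcoeff (e + d) (P * Q) l = (\<Sum>j\<le>e. \<Sum>i\<le>d. if i + j = l then hcoeff e P j * hcoeff d Q i else 0)"
proof -
  let ?p = "\<lambda>b a. coeff (coeff P b) a" and ?q = "\<lambda>b a. coeff (coeff Q b) a"
  have p0: "?p b a = 0" if "a + b \<noteq> e" for a b
    using P that by (auto simp: homog_def simp flip: of_nat_add)
  have q0: "?q b a = 0" if "a + b \<noteq> d" for a b
    using Q that by (auto simp: homog_def simp flip: of_nat_add)
  have "hcoeff (e + d) (P * Q) l =
      (\<Sum>b\<le>e + d - l. \<Sum>a\<le>l. ?p b a * ?q (e + d - l - b) (l - a))"
    by (simp add: hcoeff_def coeff_mult coeff_sum)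
  also have "\<dots> = (\<Sum>a\<le>l. \<Sum>b\<le>e + d - l. ?p b a * ?q (e + d - l - b) (l - a))"
    by (rule sum.swap)
  also have "\<dots> = (\<Sum>a\<le>l. if a \<le> e \<and> l - a \<le> d then hcoeff e P a * hcoeff d Q (l - a) else 0)"
  proof (rule sum.cong)
    fix a assume "a \<in> {..l}"
    then have al: "a \<le> l" by simp
    show "(\<Sum>b\<le>e + d - l. ?p b a * ?q (e + d - l - b) (l - a)) =
        (if a \<le> e \<and> l - a \<le> d then hcoeff e P a * hcoeff d Q (l - a) else 0)"
    proof (cases "a \<le> e \<and> l - a \<le> d")
      case True
      have "(\<Sum>b\<le>e + d - l. ?p b a * ?q (e + d - l - b) (l - a)) =
          (\<Sum>b\<in>{e - a}. ?p b a * ?q (e + d - l - b) (l - a))"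
      proof (rule sum.mono_neutral_right)
        show "{e - a} \<subseteq> {..e + d - l}" using True al l by auto
        show "\<forall>b\<in>{..e + d - l} - {e - a}. ?p b a * ?q (e + d - l - b) (l - a) = 0"
          using True by (auto intro!: p0)
      qed simp
      moreover have "e + d - l - (e - a) = d - (l - a)" using True al by auto
      ultimately show ?thesis unfolding hcoeff_def if_P[OF True] by (simp only: sum.insert sum.empty finite.emptyI empty_iff not_False_eq_True add_0_right)
    next
      case False
      have "?p b a * ?q (e + d - l - b) (l - a) = 0" if "b \<le> e + d - l" for b
      proof (cases "a \<le> e")
        case True
        then have "\<not> l - a \<le> d" using \<open>\<not> (a \<le> e \<and> l - a \<le> d)\<close> by blast
        then have "l - a + (e + d - l - b) \<noteq> d" by linarith
        from q0[OF this] show ?thesis by (rule ssubst) (rule mult_zero_right)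
      next
        case False
        then have "a + b \<noteq> e" by linarith
        from p0[OF this] show ?thesis by (rule ssubst) (rule mult_zero_left)
      qed
      then show ?thesis unfolding if_not_P[OF False] by (intro sum.neutral) blast
    qed
  qed simp
  also have "\<dots> = (\<Sum>a\<in>{a. a \<le> l \<and> a \<le> e \<and> l - a \<le> d}. hcoeff e P a * hcoeff d Q (l - a))"
    by (rule sum.mono_neutral_cong_right) auto
  also have "\<dots> = (\<Sum>j\<le>e. if j \<le> l \<and> l - j \<le> d then hcoeff e P j * hcoeff d Q (l - j) else 0)"
    by (rule sum.mono_neutral_cong_left) auto
  also have "\<dots> = (\<Sum>j\<le>e. \<Sum>i\<le>d. if i + j = l then hcoeff e P j * hcoeff d Q i else 0)"
  proof (rule sum.cong)
    fix j
    show "(if j \<le> l \<and> l - j \<le> d then hcoeff e P j * hcoeff d Q (l - j) else 0) =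
        (\<Sum>i\<le>d. if i + j = l then hcoeff e P j * hcoeff d Q i else 0)"
    proof (cases "j \<le> l")
      case True
      then have "i + j = l \<longleftrightarrow> i = l - j" for i by auto
      then show ?thesis using True by (simp add: sum.delta)
    next
      case False
      then have "i + j \<noteq> l" for i by auto
      then show ?thesis using False by simp
    qed
  qed simp
  finally show ?thesis .
qed

lemma homog_monom:
  assumes "i \<le> e"
  shows "monom (monom 1 i) (e - i) \<in> homog (int e)"
  using assms by (auto simp: homog_def split: if_splits)

lemma act_monom:
  assumes "i \<le> e"
  shows "act (int e) y (monom (monom 1 i) (e - i)) = y $ i"
proof -
  have "hcoeff e (monom (monom 1 i) (e - i)) j * y $ j = (if j = i then y $ j else 0)" for j
    using assms by (auto simp: hcoeff_def)
  moreover have "nat (int e + 1) = Suc e" by simp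
  ultimately show ?thesis using assms by (simp add: act_def sum.delta del: sum.lessThan_Suc)
qed

text \<open>\<open>mult_adj n d Q\<close> is the adjoint of \<open>P \<mapsto> P * Q\<close>.\<close>

theorem mult_adj_iff:
  fixes Q :: "'k::field poly poly"
  assumes d: "int d \<le> n + 1" and Q: "Q \<in> homog (int d)" and x: "x \<in> seqs n"
  shows "y = mult_adj n d Q x \<longleftrightarrow>
    y \<in> seqs (n - int d) \<and> (\<forall>P\<in>homog (n - int d). act (n - int d) y P = act n x (P * Q))"
proof (cases "int d = n + 1")
  case True
  then have n: "n - int d = -1" by simp
  have "homog (-1) = {0 :: 'k poly poly}"
    by (auto simp: homog_def poly_eq_iff simp flip: of_nat_add)
  moreover have "y \<in> seqs (-1) \<longleftrightarrow> y = mult_adj n d Q x"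
    using n by (auto simp: seqs_def mult_adj_def)
  ultimately show ?thesis by (simp add: n) (simp add: act_def hcoeff_def)
next
  case False
  define e where "e = nat (n - int d)"
  have n: "n = int (e + d)" and ne: "n - int d = int e" using d False by (auto simp: e_def)
  have adj: "act (int e) (mult_adj n d Q x) P = act n x (P * Q)"
    if P: "P \<in> homog (int e)" for P
  proof -
    have r: "{..<nat (n + 1)} = {..e + d}" "{..<nat (int e + 1)} = {..e}" using n by auto
    have "act n x (P * Q) = (\<Sum>l\<le>e + d. \<Sum>j\<le>e. \<Sum>i\<le>d.
        if i + j = l then hcoeff e P j * hcoeff d Q i * x $ l else 0)"
      unfolding act_def r
      by (intro sum.cong)
        (auto simp: n hcoeff_mult[OF P Q] sum_distrib_right if_distrib[of "\<lambda>c. c * _"]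
          simp flip: of_nat_add intro!: sum.cong)
    also have "\<dots> = (\<Sum>j\<le>e. \<Sum>l\<le>e + d. \<Sum>i\<le>d.
        if i + j = l then hcoeff e P j * hcoeff d Q i * x $ l else 0)"
      by (rule sum.swap)
    also have "\<dots> = (\<Sum>j\<le>e. \<Sum>i\<le>d. \<Sum>l\<le>e + d.
        if i + j = l then hcoeff e P j * hcoeff d Q i * x $ l else 0)"
      by (intro sum.cong sum.swap refl)
    also have "\<dots> = (\<Sum>j\<le>e. \<Sum>i\<le>d. hcoeff e P j * hcoeff d Q i * x $ (i + j))"
      by (intro sum.cong refl) (simp add: sum.delta')
    also have "\<dots> = act (int e) (mult_adj n d Q x) P"
      unfolding act_def r mult_adj_def ne
      by (intro sum.cong) (auto simp: sum_distrib_left mult.assoc)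
    finally show ?thesis by simp
  qed
  have carr: "mult_adj n d Q x \<in> seqs (int e)"
    by (simp add: seqs_def mult_adj_def ne)
  have uniq: "y = mult_adj n d Q x"
    if y: "y \<in> seqs (int e)" and a: "\<forall>P\<in>homog (int e). act (int e) y P = act n x (P * Q)"
  proof (rule eq_vecI)
    show "dim_vec y = dim_vec (mult_adj n d Q x)"
      using y carr by (auto simp: seqs_def)
    fix i assume "i < dim_vec (mult_adj n d Q x)"
    then have i: "i \<le> e" using carr by (auto simp: seqs_def)
    show "y $ i = mult_adj n d Q x $ i"
      using a adj homog_monom[OF i] act_monom[OF i] by metis
  qed
  show ?thesis unfolding ne using adj carr uniq by blast
qed

end

(*
  Let A_d be the space of forms of degree d whose multiplication adjoint kills x, c_d its number of
  elements, and q the order of the field. The bilinear form (P, Q) |-> x(PQ) gives the symmetry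
  c_d q^(n-d+1) = c_(n-d) q^(d+1), and A_(d-1) = {R : YR, ZR in A_d} gives c_d^2 <= c_(d-1) c_(d+1).
  Together they force c_m = q c_(m-1) whenever A_m is nonzero and 2m <= n+1. On the other hand,
  the kernel determines the form up to a scalar, so (c_d - 1)/(q - 1) elements of P_d contain x.
*)

theory Submission
  imports Defs
begin

hide_const (open) Module.smult

text \<open>By the last count, the right-hand side at \<open>x\<close> is ((c_m - q c_(m-1)) + (q -
  1))/(q - 1). This explains the coefficient q: the value is 1 exactly when c_m = q c_(m-1). If A_m
  is zero, so is A_(m-1), and the value is 0. In terms of dimensions, log-convexity says that the
  slopes of d |-> dim A_d are nondecreasing, and the symmetry pairs slopes that add up to 2, so
  slopes up to the middle are at most 1. Being integers, they are 0 and then 1. No dimension is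
  introduced: subspaces are finite sets, ratios of cardinalities stand for slopes, and integrality
  enters through \<open>card_lin_extend_le\<close>, by which a proper subspace has at most 1/q of
  the elements.\<close>

definition polys_below :: "nat \<Rightarrow> 'k::field poly set" where
  "polys_below D = {p. \<forall>i\<ge>D. coeff p i = 0}"

text \<open>Sequences are polynomials too, so that one counting lemma serves both for pairs of forms
  and for a form against a sequence.\<close>

definition pairing :: "nat \<Rightarrow> 'k::field poly \<Rightarrow> 'k poly \<Rightarrow> 'k" where
  "pairing N p x = (\<Sum>i<N. coeff p i * coeff x i)"

text \<open>Forms of degree \<open>d\<close> are dehomogenised (\<open>Z = 1\<close>) and \<open>D\<close> stands for \<open>d + 1\<close>, so that
  \<open>D = 0\<close> is degree \<open>-1\<close>; the sequence is given by its generating polynomial \<open>x\<close> of length \<open>N = n + 1\<close>.\<close>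

definition ann :: "nat \<Rightarrow> 'k::field poly \<Rightarrow> nat \<Rightarrow> 'k poly set" where
  "ann N x D = {p \<in> polys_below D. \<forall>u\<in>polys_below (Suc N - D). pairing N (p * u) x = 0}"

definition lin_closed :: "'k::field poly set \<Rightarrow> bool" where
  "lin_closed S \<longleftrightarrow> 0 \<in> S \<and> (\<forall>p\<in>S. \<forall>r\<in>S. p + r \<in> S) \<and> (\<forall>c. \<forall>p\<in>S. smult c p \<in> S)"

lemma lin_closedD:
  assumes "lin_closed S"
  shows "0 \<in> S" "p \<in> S \<Longrightarrow> r \<in> S \<Longrightarrow> p + r \<in> S" "p \<in> S \<Longrightarrow> smult c p \<in> S"
    "p \<in> S \<Longrightarrow> r \<in> S \<Longrightarrow> p - r \<in> S"
proof -
  show "0 \<in> S" "p \<in> S \<Longrightarrow> r \<in> S \<Longrightarrow> p + r \<in> S" "p \<in> S \<Longrightarrow> smult c p \<in> S"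
    using assms by (auto simp: lin_closed_def)
  have "p - r = p + smult (-1) r" by simp
  then show "p \<in> S \<Longrightarrow> r \<in> S \<Longrightarrow> p - r \<in> S"
    using assms unfolding lin_closed_def by metis
qed

lemma lin_closed_polys_below: "lin_closed (polys_below D)"
  by (auto simp: lin_closed_def polys_below_def)

lemma pairing_simps:
  "pairing N (p + r) x = pairing N p x + pairing N r x"
  "pairing N (p - r) x = pairing N p x - pairing N r x"
  "pairing N (smult c p) x = c * pairing N p x"
  "pairing N p (x + y) = pairing N p x + pairing N p y"
  "pairing N p (smult c x) = c * pairing N p x"
  "pairing N 0 x = 0"
  by (simp_all add: pairing_def sum.distrib sum_subtractf sum_distrib_left algebra_simps)

lemma lin_closed_ann: "lin_closed (ann N x D)"
  using lin_closed_polys_below[of D]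
  by (auto simp: lin_closed_def ann_def pairing_simps distrib_right)

lemma polys_below_mono: "D \<le> E \<Longrightarrow> polys_below D \<subseteq> polys_below E"
  by (auto simp: polys_below_def)

lemma pCons_in_polys_below_Suc: "pCons a p \<in> polys_below (Suc D) \<longleftrightarrow> p \<in> polys_below D"
proof
  assume "pCons a p \<in> polys_below (Suc D)"
  then have "coeff (pCons a p) (Suc i) = 0" if "i \<ge> D" for i
    using that unfolding polys_below_def by blast
  then show "p \<in> polys_below D" by (simp add: polys_below_def)
next
  assume "p \<in> polys_below D"
  then show "pCons a p \<in> polys_below (Suc D)"
    by (auto simp: polys_below_def coeff_pCons split: nat.split)
qed

text \<open>The bounds are lengths, that is degrees plus one; hence \<open>Suc N\<close> and not
  \<open>N\<close>.\<close>

lemma polys_below_mult: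
  assumes "p \<in> polys_below D" "u \<in> polys_below E" "D + E \<le> Suc N"
  shows "p * u \<in> polys_below N"
proof -
  have "coeff (p * u) i = 0" if "i \<ge> N" for i
    unfolding coeff_mult
  proof (rule sum.neutral, safe)
    fix j assume "j \<le> i"
    then have "D \<le> j \<or> E \<le> i - j" using that assms(3) by linarith
    then show "coeff p j * coeff u (i - j) = 0"
      using assms(1,2) by (auto simp: polys_below_def)
  qed
  then show ?thesis by (simp add: polys_below_def)
qed

section \<open>Linear algebra over a finite field by counting\<close>

lemma card_polys_below:
  "finite (polys_below D :: 'k::{field,finite} poly set) \<and>
   card (polys_below D :: 'k::{field,finite} poly set) = CARD('k) ^ D"
proof (induction D)
  case 0
  have "polys_below 0 = {0 :: 'k poly}" by (auto simp: polys_below_def poly_eq_iff)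
  then show ?case by simp
next
  case (Suc D)
  have eq: "polys_below (Suc D) = (\<lambda>(a, p). pCons a p) ` (UNIV \<times> (polys_below D :: 'k poly set))"
  proof (safe, goal_cases)
    case (1 p)
    obtain a r where "p = pCons a r" by (rule pCons_cases)
    with 1 show ?case by (auto simp: pCons_in_polys_below_Suc intro!: image_eqI[of _ _ "(a, r)"])
  qed (simp add: pCons_in_polys_below_Suc)
  have "inj_on (\<lambda>(a, p). pCons a p) (UNIV \<times> (polys_below D :: 'k poly set))"
    by (auto simp: inj_on_def)
  with Suc show ?case by (auto simp: eq card_image card_cartesian_product)
qed

lemma card_field_gt_1: "CARD('k::{field,finite}) > 1"
  using card_mono[of "UNIV :: 'k set" "{0, 1}"] by simp

lemma finite_subset_polys_below: "S \<subseteq> polys_below D \<Longrightarrow> finite (S :: 'k::{field,finite} poly set)"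
  by (erule finite_subset) (rule card_polys_below[THEN conjunct1])

lemma finite_ann: "finite (ann N x D :: 'k::{field,finite} poly set)"
  by (force intro!: finite_subset_polys_below[of _ D] simp: ann_def)

text \<open>The translates of \<open>S\<close> by the multiples of \<open>w\<close> are disjoint: an
  overlap would put a nonzero multiple of \<open>w\<close> into \<open>S\<close>.\<close>

lemma card_lin_extend_le:
  fixes S T :: "'k::{field,finite} poly set"
  assumes S: "lin_closed S" and T: "lin_closed T" and ST: "S \<subseteq> T" and fin: "finite T"
    and w: "w \<in> T" "w \<notin> S"
  shows "CARD('k) * card S \<le> card T"
proof -
  let ?f = "\<lambda>(t, v). v + smult t w"
  have "inj_on ?f (UNIV \<times> S)"
  proof (rule inj_onI, clarify)
    fix t v t' v' assume *: "v \<in> S" "v' \<in> S" "v + smult t w = v' + smult t' w"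
    have d: "smult (t - t') w = v' - v" using *(3) by (simp add: smult_diff_left algebra_simps)
    have "t = t'"
    proof (rule ccontr)
      assume "t \<noteq> t'"
      then have "w = smult (inverse (t - t')) (smult (t - t') w)" by simp
      also have "\<dots> \<in> S" unfolding d using * lin_closedD[OF S] by blast
      finally show False using w by simp
    qed
    with * show "t = t' \<and> v = v'" by simp
  qed
  then have "card (?f ` (UNIV \<times> S)) = CARD('k) * card S"
    by (simp add: card_image card_cartesian_product)
  moreover have "?f ` (UNIV \<times> S) \<subseteq> T"
    using ST w lin_closedD[OF T] by auto
  ultimately show ?thesis using card_mono[OF fin] by metis
qed

text \<open>If \<open>f w\<close> is nonzero, \<open>v\<close> is determined by \<open>f v\<close>
  and its projection to the kernel along \<open>w\<close>. The factor q avoids a division.\<close>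

lemma card_functional_kernel:
  fixes V :: "'k::{field,finite} poly set"
  assumes V: "lin_closed V" and fin: "finite V"
    and add: "\<And>v w. f (v + w) = f v + f w" and scale: "\<And>c v. f (smult c v) = c * f v"
  shows "CARD('k) * card {v \<in> V. f v = (0::'k)} =
    (if \<forall>v\<in>V. f v = 0 then CARD('k) * card V else card V)"
proof (cases "\<forall>v\<in>V. f v = 0")
  case True
  then have "{v \<in> V. f v = 0} = V" by auto
  with True show ?thesis by simp
next
  case False
  then obtain w where w: "w \<in> V" "f w \<noteq> 0" by blast
  let ?S = "{v \<in> V. f v = 0}" and ?g = "\<lambda>v. (f v, v - smult (f v / f w) w)"
  have f0: "f 0 = 0" using scale[of 0 0] by simp
  have diff: "f (a - b) = f a - f b" for a b using add[of "a - b" b] by simp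
  have "lin_closed ?S"
    using lin_closedD[OF V] f0 by (auto simp: lin_closed_def add scale)
  then have "CARD('k) * card ?S \<le> card V"
    using w fin V by (intro card_lin_extend_le[of _ _ w]) auto
  moreover have "card V \<le> card ((UNIV :: 'k set) \<times> ?S)"
  proof (rule card_inj_on_le)
    show "inj_on ?g V" by (auto simp: inj_on_def)
    show "?g ` V \<subseteq> (UNIV :: 'k set) \<times> ?S" using w lin_closedD[OF V] by (auto simp: diff scale)
    show "finite ((UNIV :: 'k set) \<times> ?S)" using fin by simp
  qed
  ultimately show ?thesis unfolding if_not_P[OF False] by (simp add: card_cartesian_product)
qed

text \<open>Both sides count the pairs \<open>(u, v)\<close> with \<open>B u v = 0\<close>; this replaces the equality of row
  rank and column rank.\<close>

lemma card_radicals: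
  fixes U V :: "'k::{field,finite} poly set"
  assumes U: "lin_closed U" "finite U" and V: "lin_closed V" "finite V"
    and B: "\<And>u v w. B (u + v) w = B u w + B v w" "\<And>c u w. B (smult c u) w = c * B u w"
      "\<And>u v w. B u (v + w) = B u v + B u w" "\<And>c u w. B u (smult c w) = c * (B u w :: 'k)"
  shows "card {u \<in> U. \<forall>v\<in>V. B u v = 0} * card V = card {v \<in> V. \<forall>u\<in>U. B u v = 0} * card U"
proof -
  have q: "CARD('k) > 1" by (rule card_field_gt_1)
  \<comment> \<open>A fixed \<open>u\<close> is orthogonal to all of \<open>V\<close> if it lies in
    the radical, and to a fraction 1/q of it otherwise. The first summand is symmetric in
    \<open>U\<close> and \<open>V\<close>, so double counting leaves only the radical terms.\<close>
  have count: "int CARD('k) * int (\<Sum>u\<in>U. card {v \<in> V. B u v = 0}) =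
      int (card U * card V) + (int CARD('k) - 1) * int (card {u \<in> U. \<forall>v\<in>V. B u v = 0} * card V)"
    if fin: "finite U" and V: "lin_closed V" "finite V"
      and B: "\<And>u v w. B u (v + w) = B u v + B u w" "\<And>c u w. B u (smult c w) = c * (B u w :: 'k)"
    for U V and B :: "'k poly \<Rightarrow> 'k poly \<Rightarrow> 'k"
  proof -
    let ?R = "{u \<in> U. \<forall>v\<in>V. B u v = 0}"
    have "int CARD('k) * int (\<Sum>u\<in>U. card {v \<in> V. B u v = 0}) =
        (\<Sum>u\<in>U. int (CARD('k) * card {v \<in> V. B u v = 0}))"
      by (simp add: sum_distrib_left)
    also have "\<dots> = (\<Sum>u\<in>U. int (card V) +
        (if u \<in> ?R then (int CARD('k) - 1) * int (card V) else 0))"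
    proof (rule sum.cong[OF refl])
      fix u assume "u \<in> U"
      then show "int (CARD('k) * card {v \<in> V. B u v = 0}) =
          int (card V) + (if u \<in> ?R then (int CARD('k) - 1) * int (card V) else 0)"
        unfolding card_functional_kernel[OF V, of "B u", OF B] by (simp add: algebra_simps)
    qed
    also have "\<dots> = int (card U * card V) + (\<Sum>u\<in>?R. (int CARD('k) - 1) * int (card V))"
      unfolding sum.distrib using fin by (simp add: sum.inter_filter del: sum_constant) simp
    finally show ?thesis by (simp add: algebra_simps)
  qed
  have "(\<Sum>u\<in>U. card {v \<in> V. B u v = 0}) = (\<Sum>v\<in>V. card {u \<in> U. B u v = 0})"
  proof -
    have *: "card {v \<in> S. P v} = (\<Sum>v\<in>S. if P v then 1 else 0)" if "finite S" for S :: "'k poly set" and P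
      using that by (simp add: sum.If_cases Int_def)
    show ?thesis using U V by (simp add: * del: sum.If_cases) (rule sum.swap)
  qed
  with count[of U V B, OF U(2) V] count[of V U "\<lambda>v u. B u v", OF V(2) U] B
  have "(int CARD('k) - 1) * int (card {u \<in> U. \<forall>v\<in>V. B u v = 0} * card V) =
      (int CARD('k) - 1) * int (card {v \<in> V. \<forall>u\<in>U. B u v = 0} * card U)"
    by (simp add: mult.commute)
  with q have "int (card {u \<in> U. \<forall>v\<in>V. B u v = 0} * card V) =
      int (card {v \<in> V. \<forall>u\<in>U. B u v = 0} * card U)" by simp
  then show ?thesis by (simp only: of_nat_eq_iff)
qed

section \<open>Cardinalities of the annihilators of a fixed sequence\<close>

text \<open>With complementary lengths, each of the two spaces is the test space of the other, so
  the annihilators are the two radicals of one bilinear form.\<close>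

lemma card_ann_symmetric:
  fixes x :: "'k::{field,finite} poly"
  assumes "D + E = Suc N"
  shows "card (ann N x D) * CARD('k) ^ E = card (ann N x E) * CARD('k) ^ D"
proof -
  have DE: "Suc N - D = E" "Suc N - E = D" using assms by auto
  have "ann N x E = {u \<in> polys_below E. \<forall>p\<in>polys_below D. pairing N (p * u) x = 0}"
    unfolding ann_def DE by (simp add: mult.commute)
  moreover have "ann N x D = {p \<in> polys_below D. \<forall>u\<in>polys_below E. pairing N (p * u) x = 0}"
    unfolding ann_def DE ..
  ultimately show ?thesis
    using card_radicals[of "polys_below D :: 'k poly set" "polys_below E" "\<lambda>p u. pairing N (p * u) x"]
      card_polys_below[where 'k = 'k]
    by (simp add: lin_closed_polys_below distrib_left distrib_right pairing_simps)
qed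

lemma ann_Suc_mono: "ann N x D \<subseteq> ann N x (Suc D)"
  using subsetD[OF polys_below_mono[of D "Suc D"]] subsetD[OF polys_below_mono[of "Suc N - Suc D" "Suc N - D"]]
  by (fastforce simp: ann_def)

lemma card_ann_pos: "card (ann N x D :: 'k::{field,finite} poly set) > 0"
  using lin_closedD(1)[OF lin_closed_ann, of N x D] by (auto simp: card_gt_0_iff finite_ann)

lemma card_le_fibers:
  assumes "finite T" "f ` S \<subseteq> T" "\<And>y. y \<in> T \<Longrightarrow> card {s \<in> S. f s = y} \<le> k" "finite S"
  shows "card S \<le> k * card T"
proof -
  have "card S = (\<Sum>y\<in>T. card {s \<in> S. f s = y})"
    using sum.group[of S T f "\<lambda>_. 1::nat"] assms by simp
  also have "\<dots> \<le> (\<Sum>y\<in>T. k)" by (rule sum_mono) (use assms in auto)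
  finally show ?thesis by (simp add: mult.commute)
qed

text \<open>The map \<open>(P, Q) \<mapsto> Y P - Z Q\<close> sends pairs of annihilators of degree \<open>d\<close> to annihilators of
  degree \<open>d + 1\<close>, and its kernel is a copy of the annihilators of degree \<open>d - 1\<close>.\<close>

lemma card_ann_log_convex:
  fixes x :: "'k::{field,finite} poly"
  assumes D: "Suc D \<le> N"
  shows "card (ann N x (Suc D)) ^ 2 \<le> card (ann N x D) * card (ann N x (Suc (Suc D)))"
proof -
  \<comment> \<open>At \<open>Z = 1\<close>, multiplication by \<open>Y\<close> is
    \<open>pCons 0\<close> and multiplication by \<open>Z\<close> is an inclusion of spaces.\<close>
  let ?A = "ann N x (Suc D)" and ?f = "\<lambda>(P, Q). pCons 0 P - Q"
  have im: "pCons 0 P - Q \<in> ann N x (Suc (Suc D))" if "P \<in> ?A" "Q \<in> ?A" for P Q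
  proof -
    have "pCons 0 P - Q \<in> polys_below (Suc (Suc D))"
      using that lin_closed_polys_below polys_below_mono[of "Suc D" "Suc (Suc D)"]
      by (intro lin_closedD(4)) (auto simp: ann_def pCons_in_polys_below_Suc)
    moreover have "pairing N ((pCons 0 P - Q) * u) x = 0"
      if u: "u \<in> polys_below (Suc N - Suc (Suc D))" for u
    proof -
      have e: "Suc N - Suc D = Suc (Suc N - Suc (Suc D))" using D by simp
      have "pCons 0 u \<in> polys_below (Suc N - Suc D)" unfolding e pCons_in_polys_below_Suc by (rule u)
      moreover have "u \<in> polys_below (Suc N - Suc D)" using u e polys_below_mono by (metis le_SucI order_refl subsetD)
      moreover have "(pCons 0 P - Q) * u = P * pCons 0 u - Q * u" by (simp add: left_diff_distrib)
      ultimately show ?thesis using \<open>P \<in> ?A\<close> \<open>Q \<in> ?A\<close>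
        by (simp add: ann_def pairing_simps del: mult_pCons_left mult_pCons_right)
    qed
    ultimately show ?thesis by (simp add: ann_def)
  qed
  have ker: "P \<in> ann N x D" if P: "P \<in> ?A" and Q: "pCons 0 P \<in> ?A" for P
  proof -
    have "P \<in> polys_below D" using Q by (simp add: ann_def pCons_in_polys_below_Suc)
    moreover have "pairing N (P * u) x = 0" if u: "u \<in> polys_below (Suc N - D)" for u
    proof -
      \<comment> \<open>Write \<open>u\<close> as \<open>a + Y v\<close>: the part
        \<open>a P\<close> vanishes because \<open>P\<close> is an annihilator tested against
        \<open>1\<close>, the part \<open>(Y P) v\<close> because \<open>Y P\<close> is one.\<close>
      obtain a v where uv: "u = pCons a v" by (rule pCons_cases)
      have e: "Suc N - D = Suc (Suc N - Suc D)" using D by simp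
      have v: "v \<in> polys_below (Suc N - Suc D)" using u unfolding uv e pCons_in_polys_below_Suc .
      have e': "Suc N - Suc D = Suc (Suc N - Suc (Suc D))" using D by simp
      have "1 \<in> polys_below (Suc N - Suc D)" unfolding e' one_pCons pCons_in_polys_below_Suc
        by (simp add: polys_below_def)
      then have "pairing N P x = 0" using P by (auto simp: ann_def)
      moreover have "P * u = smult a P + pCons 0 P * v" by (simp add: uv)
      ultimately show ?thesis using Q v
        by (simp add: ann_def pairing_simps del: mult_pCons_left mult_pCons_right)
    qed
    ultimately show ?thesis by (simp add: ann_def)
  qed
  have "card (?A \<times> ?A) \<le> card (ann N x D) * card (ann N x (Suc (Suc D)))"
  proof (rule card_le_fibers)
    show "?f ` (?A \<times> ?A) \<subseteq> ann N x (Suc (Suc D))" using im by auto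
    fix y
    \<comment> \<open>A nonempty fibre is a translate of the kernel, and in a fibre \<open>P\<close>
      determines \<open>Q\<close>.\<close>
    show "card {s \<in> ?A \<times> ?A. ?f s = y} \<le> card (ann N x D)"
    proof (cases "{s \<in> ?A \<times> ?A. ?f s = y} = {}")
      case False
      then obtain P0 Q0 where s: "P0 \<in> ?A" "Q0 \<in> ?A" "pCons 0 P0 - Q0 = y" by auto
      show ?thesis
      proof (rule card_inj_on_le[where f = "\<lambda>(P, Q). P - P0"])
        show "inj_on (\<lambda>(P, Q). P - P0) {s \<in> ?A \<times> ?A. ?f s = y}" by (auto simp: inj_on_def)
        show "(\<lambda>(P, Q). P - P0) ` {s \<in> ?A \<times> ?A. ?f s = y} \<subseteq> ann N x D"
        proof (clarify)
          fix P Q assume PQ: "P \<in> ?A" "Q \<in> ?A" "y = pCons 0 P - Q"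
          have "pCons 0 (P - P0) = pCons 0 P - pCons 0 P0" by simp
          also have "\<dots> = Q - Q0" using PQ s by (simp only: diff_eq_eq add_ac diff_add_cancel) (simp add: algebra_simps)
          finally have "pCons 0 (P - P0) = Q - Q0" .
          then show "P - P0 \<in> ann N x D"
            using PQ s lin_closedD(4)[OF lin_closed_ann] by (intro ker) auto
        qed
      qed (rule finite_ann)
    next
      case True
      show ?thesis unfolding True by simp
    qed
  qed (simp_all add: finite_ann)
  then show ?thesis by (simp add: card_cartesian_product power2_eq_square)
qed

text \<open>By log-convexity the ratios \<open>r D\<close> of consecutive cardinalities are nondecreasing, and by symmetry
  \<open>r D * r (N - D) = q\<^sup>2\<close>; hence \<open>r m \<le> q\<close>. If \<open>r m = 1\<close>, then all earlier ratios are \<open>1\<close>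
  as well.\<close>

lemma card_ann_Suc:
  fixes x :: "'k::{field,finite} poly"
  assumes m: "2 * m \<le> N" and nontriv: "card (ann N x (Suc m)) > 1"
  shows "card (ann N x (Suc m)) = CARD('k) * card (ann N x m)"
proof -
  let ?c = "\<lambda>D. real (card (ann N x D))" and ?q = "real CARD('k)"
  define r where "r D = ?c (Suc D) / ?c D" for D
  have pos: "?c D > 0" for D using card_ann_pos by auto
  have step: "r D \<le> r (Suc D)" if "Suc D \<le> N" for D
  proof -
    have "?c (Suc D) ^ 2 \<le> ?c D * ?c (Suc (Suc D))"
      using card_ann_log_convex[OF that, of x] by (simp only: flip: of_nat_mult of_nat_power of_nat_le_iff)
    then show ?thesis using pos by (simp add: r_def divide_simps power2_eq_square mult.commute)
  qed
  have mono: "r D \<le> r E" if "D \<le> E" "E \<le> N" for D E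
    using that by (induction E rule: dec_induct) (auto intro: order_trans step)
  have le: "?c (Suc m) \<le> ?q * ?c m"
  proof -
    have sym: "?c D * ?q ^ E = ?c E * ?q ^ D" if "D + E = Suc N" for D E
      using card_ann_symmetric[OF that, of x] by (simp only: flip: of_nat_mult of_nat_power)
    have "r m * r (N - m) = ?q ^ 2"
    proof -
      obtain l where l: "N = m + l" using m by (metis add_leE le_add_diff_inverse mult_2)
      \<comment> \<open>Numerators and denominators of the two ratios are matched crosswise:
        \<open>m\<close> with \<open>Suc l\<close>, and \<open>Suc m\<close> with
        \<open>l\<close>.\<close>
      have 1: "?c m * ?q ^ Suc l = ?c (Suc l) * ?q ^ m" using l by (intro sym) auto
      have 2: "?c (Suc m) * ?q ^ l = ?c l * ?q ^ Suc m" using l by (intro sym) auto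
      have qp: "?q > 0" using card_field_gt_1[where 'k = 'k] by simp
      have "(?c (Suc m) * ?c (Suc l)) * (?q ^ l * ?q ^ m) = (?c (Suc m) * ?q ^ l) * (?c (Suc l) * ?q ^ m)"
        by (simp only: mult_ac)
      also have "\<dots> = (?c l * ?q ^ Suc m) * (?c m * ?q ^ Suc l)" by (simp only: 1 2)
      also have "\<dots> = (?q ^ 2 * (?c m * ?c l)) * (?q ^ l * ?q ^ m)" by (simp add: power2_eq_square)
      finally have "?c (Suc m) * ?c (Suc l) = ?q ^ 2 * (?c m * ?c l)" using qp by simp
      moreover have "N - m = l" using l by simp
      moreover have "?c m * ?c l \<noteq> 0" using pos[of m] pos[of l] by simp
      ultimately show ?thesis by (simp add: r_def nonzero_divide_eq_eq)
    qed
    \<comment> \<open>Here \<open>2 * m \<le> N\<close> places \<open>m\<close> in the first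
      half.\<close>
    moreover have "r m \<le> r (N - m)" by (rule mono) (use m in auto)
    moreover have "r m > 0" using pos by (simp add: r_def)
    ultimately have "r m ^ 2 \<le> ?q ^ 2" by (metis power2_eq_square mult_left_mono less_imp_le)
    then have "r m \<le> ?q" by (rule power2_le_imp_le) simp
    then show ?thesis using pos by (simp add: r_def divide_simps mult.commute)
  qed
  have ne: "ann N x m \<noteq> ann N x (Suc m)"
  proof
    assume eq: "ann N x m = ann N x (Suc m)"
    have "r m = 1" using pos[of "Suc m"] by (simp add: r_def eq)
    have *: "?c (Suc D) \<le> ?c D" if "D \<le> m" for D
    proof -
      have "r D \<le> 1" unfolding \<open>r m = 1\<close>[symmetric] using that m by (intro mono) auto
      then show ?thesis using pos[of D] by (simp add: r_def)
    qed
    have "?c D \<le> ?c 0" if "D \<le> Suc m" for D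
      using that by (induction D) (auto intro: order_trans dest: *)
    \<comment> \<open>Index 0 is degree -1, where the only form is zero; so the chain of
      inequalities ends at 1.\<close>
    moreover have "card (ann N x 0) \<le> 1"
    proof -
      have "ann N x 0 \<subseteq> {0}" by (auto simp: ann_def polys_below_def poly_eq_iff)
      from card_mono[OF _ this] show ?thesis by simp
    qed
    ultimately have "?c (Suc m) \<le> 1" by (meson order_refl order_trans of_nat_le_1_iff)
    with nontriv show False by simp
  qed
  \<comment> \<open>A strict inclusion gains at least a factor q, and \<open>le\<close> allows at
    most that.\<close>
  then obtain w where "w \<in> ann N x (Suc m)" "w \<notin> ann N x m" using ann_Suc_mono by blast
  then have "CARD('k) * card (ann N x m) \<le> card (ann N x (Suc m))"
    using ann_Suc_mono lin_closed_ann finite_ann by (intro card_lin_extend_le) auto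
  moreover have "card (ann N x (Suc m)) \<le> CARD('k) * card (ann N x m)"
    using le by (simp only: flip: of_nat_mult of_nat_le_iff)
  ultimately show ?thesis by simp
qed

text \<open>By linearity it suffices to test against monomials; testing against the
  \<open>j\<close>-th one is the \<open>j\<close>-th recurrence equation.\<close>

lemma ann_iff_sums:
  assumes p: "p \<in> polys_below D"
  shows "p \<in> ann N x D \<longleftrightarrow> (\<forall>j. j + D \<le> N \<longrightarrow> (\<Sum>i<D. coeff p i * coeff x (i + j)) = 0)"
proof -
  have sh: "pairing N (p * monom 1 j) x = (\<Sum>i<D. coeff p i * coeff x (i + j))" if "j + D \<le> N" for j
  proof -
    have "pairing N (p * monom 1 j) x = (\<Sum>i<N. if j \<le> i \<and> i < j + D then coeff p (i - j) * coeff x i else 0)"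
      unfolding pairing_def using p
      by (intro sum.cong refl) (auto simp: coeff_monom_mult mult.commute[of p] polys_below_def)
    also have "\<dots> = (\<Sum>i\<in>{j..<j + D}. coeff p (i - j) * coeff x i)"
      using that by (intro sum.mono_neutral_cong_right) auto
    also have "\<dots> = (\<Sum>i<D. coeff p i * coeff x (i + j))"
      by (rule sum.reindex_bij_witness[of _ "\<lambda>i. i + j" "\<lambda>i. i - j"]) auto
    finally show ?thesis .
  qed
  have ex: "pairing N (p * u) x = (\<Sum>j\<le>degree u. coeff u j * pairing N (p * monom 1 j) x)" for u
  proof -
    have "p * u = (\<Sum>j\<le>degree u. smult (coeff u j) (p * monom 1 j))"
      by (subst (1) poly_as_sum_of_monoms[of u, symmetric])
        (simp add: sum_distrib_left smult_monom flip: mult_smult_right)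
    moreover have "pairing N (\<Sum>j\<in>S. f j) x = (\<Sum>j\<in>S. pairing N (f j) x)" if "finite S" for f and S :: "nat set"
      using that by induction (auto simp: pairing_simps)
    ultimately show ?thesis by (simp add: pairing_simps)
  qed
  show ?thesis
  proof
    assume a: "p \<in> ann N x D"
    have "monom 1 j \<in> (polys_below (Suc N - D) :: 'a poly set)" if "j + D \<le> N" for j :: nat
      using that by (auto simp: polys_below_def)
    with a sh show "\<forall>j. j + D \<le> N \<longrightarrow> (\<Sum>i<D. coeff p i * coeff x (i + j)) = 0"
      by (auto simp: ann_def)
  next
    assume a: "\<forall>j. j + D \<le> N \<longrightarrow> (\<Sum>i<D. coeff p i * coeff x (i + j)) = 0"
    have "coeff u j * pairing N (p * monom 1 j) x = 0" if "u \<in> polys_below (Suc N - D)" for u j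
    proof (cases "j + D \<le> N")
      case True
      then show ?thesis using a sh by simp
    next
      case False
      then show ?thesis using that by (auto simp: polys_below_def)
    qed
    then have "pairing N (p * u) x = 0" if "u \<in> polys_below (Suc N - D)" for u
      unfolding ex[of u] using that by (intro sum.neutral) blast
    then show "p \<in> ann N x D" using p by (simp add: ann_def)
  qed
qed

section \<open>A kernel determines its form up to a scalar\<close>

lemma pairing_monom: "i < N \<Longrightarrow> pairing N p (monom 1 i) = coeff p i"
proof -
  assume "i < N"
  moreover have "pairing N p (monom 1 i) = (\<Sum>j<N. if j = i then coeff p j else 0)"
    unfolding pairing_def by (intro sum.cong) auto
  ultimately show ?thesis by simp
qed

text \<open>The pairing is nondegenerate, as monomials read off coefficients; one radical is
  therefore zero and \<open>card_radicals\<close> becomes the formula for orthogonal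
  complements.\<close>

lemma card_perp:
  fixes S :: "'k::{field,finite} poly set"
  assumes S: "lin_closed S" "S \<subseteq> polys_below N"
  shows "card {x \<in> polys_below N. \<forall>p\<in>S. pairing N p x = 0} * card S = CARD('k) ^ N"
proof -
  have "p = 0" if "p \<in> S" "\<forall>x\<in>polys_below N. pairing N p x = 0" for p
  proof (rule poly_eqI)
    fix i
    show "coeff p i = coeff 0 i"
    proof (cases "i < N")
      case True
      then have "monom 1 i \<in> (polys_below N :: 'k poly set)" by (auto simp: polys_below_def)
      with True that pairing_monom[of i N p] show ?thesis by simp
    next
      case False
      then show ?thesis using that S by (auto simp: polys_below_def)
    qed
  qed
  then have "{p \<in> S. \<forall>x\<in>polys_below N. pairing N p x = 0} = {0}"
    using lin_closedD(1)[OF S(1)] by (auto simp: pairing_simps)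
  then show ?thesis
    using card_radicals[of S "polys_below N" "pairing N"] S finite_subset_polys_below[OF S(2)]
      card_polys_below[where 'k = 'k]
    by (simp add: lin_closed_polys_below pairing_simps)
qed

text \<open>Inclusion of the kernels gives \<open>r V \<subseteq> p V\<close> by counting, where \<open>V\<close> consists of the forms of
  degree \<open>n - d\<close>. Divisibility of \<open>r Z\<^sup>n\<^sup>-\<^sup>d\<close> gives \<open>r = p u\<close>; that of \<open>r Y\<^sup>n\<^sup>-\<^sup>d\<close> makes \<open>u\<close>
  constant.\<close>

lemma ann_inclusion_imp_smult:
  fixes p r :: "'k::{field,finite} poly"
  assumes D: "D \<le> N" and p: "p \<in> polys_below D" "p \<noteq> 0" and r: "r \<in> polys_below D"
    and incl: "\<And>x. x \<in> polys_below N \<Longrightarrow> p \<in> ann N x D \<Longrightarrow> r \<in> ann N x D"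
  shows "\<exists>c. r = smult c p"
proof -
  let ?V = "polys_below (Suc N - D) :: 'k poly set"
  define S where "S = (\<lambda>u. p * u) ` ?V"
  define T where "T = {p * u + r * v |u v. u \<in> ?V \<and> v \<in> ?V}"
  have V: "lin_closed ?V" by (rule lin_closed_polys_below)
  have S: "lin_closed S" unfolding lin_closed_def S_def
    using lin_closedD[OF V] by (auto simp: image_iff simp flip: distrib_left mult_smult_right)
  have T: "lin_closed T" unfolding lin_closed_def
  proof safe
    show "0 \<in> T" unfolding T_def using lin_closedD(1)[OF V] by force
    show "s + t \<in> T" if st: "s \<in> T" "t \<in> T" for s t
    proof -
      obtain u v u' v' where "s = p * u + r * v" "t = p * u' + r * v'"
        "u \<in> ?V" "v \<in> ?V" "u' \<in> ?V" "v' \<in> ?V" using st unfolding T_def by blast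
      then show ?thesis unfolding T_def using lin_closedD[OF V]
        by (intro CollectI exI[of _ "u + u'"] exI[of _ "v + v'"]) (auto simp: algebra_simps)
    qed
    show "smult c t \<in> T" if t: "t \<in> T" for c t
    proof -
      obtain u v where "t = p * u + r * v" "u \<in> ?V" "v \<in> ?V" using t unfolding T_def by blast
      then show ?thesis unfolding T_def using lin_closedD[OF V]
        by (intro CollectI exI[of _ "smult c u"] exI[of _ "smult c v"]) (auto simp: smult_add_right)
    qed
  qed
  have mult: "s * u \<in> polys_below N" if "s \<in> polys_below D" "u \<in> ?V" for s u
    by (rule polys_below_mult[OF that]) (use D in auto)
  have Sb: "S \<subseteq> polys_below N" using mult p by (auto simp: S_def)
  have Tb: "T \<subseteq> polys_below N"
    using p r by (auto simp: T_def intro!: mult lin_closedD(2)[OF lin_closed_polys_below])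
  have ST: "S \<subseteq> T" unfolding S_def T_def
    using lin_closedD(1)[OF V] by force
  \<comment> \<open>\<open>incl\<close> says that \<open>S\<close> and the larger \<open>T\<close>
    have the same orthogonal complement; by \<open>card_perp\<close> they coincide.\<close>
  have "{x \<in> polys_below N. \<forall>s\<in>S. pairing N s x = 0} = {x \<in> polys_below N. \<forall>s\<in>T. pairing N s x = 0}"
  proof (rule Collect_cong, rule conj_cong[OF refl])
    fix x :: "'k poly" assume x: "x \<in> polys_below N"
    show "(\<forall>s\<in>S. pairing N s x = 0) = (\<forall>s\<in>T. pairing N s x = 0)"
    proof
      assume "\<forall>s\<in>S. pairing N s x = 0"
      then have "p \<in> ann N x D" using p by (auto simp: S_def ann_def)
      moreover from this have "r \<in> ann N x D" by (rule incl[OF x])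
      ultimately show "\<forall>s\<in>T. pairing N s x = 0" by (auto simp: T_def ann_def pairing_simps)
    qed (use ST in auto)
  qed
  with card_perp[OF S Sb] card_perp[OF T Tb]
  have "card {x \<in> polys_below N. \<forall>s\<in>T. pairing N s x = 0} * card S =
      card {x \<in> polys_below N. \<forall>s\<in>T. pairing N s x = 0} * card T" by simp
  moreover have "card {x \<in> polys_below N. \<forall>s\<in>T. pairing N s x = 0} \<noteq> 0"
  proof
    assume "card {x \<in> polys_below N. \<forall>s\<in>T. pairing N s x = 0} = 0"
    with card_perp[OF T Tb] have "CARD('k) ^ N = 0" by simp
    then show False using card_field_gt_1[where 'k = 'k] by simp
  qed
  ultimately have "card S = card T" by simp
  then have eq: "S = T" using ST finite_subset_polys_below[OF Tb] by (simp add: card_subset_eq)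
  have in_S: "r * v \<in> S" if "v \<in> ?V" for v
    unfolding eq T_def using that lin_closedD(1)[OF V] by force
  have "1 \<in> ?V" "monom 1 (N - D) \<in> ?V" using D by (auto simp: polys_below_def coeff_1)
  from this[THEN in_S] obtain u u' where "r * 1 = p * u" and u: "u \<in> ?V"
      and u': "r * monom 1 (N - D) = p * u'" "u' \<in> ?V"
    unfolding S_def by blast
  then have u: "r = p * u" "u \<in> ?V" by simp_all
  have "p * u' = p * (u * monom 1 (N - D))" unfolding u'(1)[symmetric] u(1) by (rule mult.assoc)
  then have "u' = u * monom 1 (N - D)" using p(2) by auto
  then have z: "coeff (monom 1 (N - D) * u) i = 0" if "i \<ge> Suc N - D" for i
    using u'(2) that by (simp add: polys_below_def mult.commute)
  have shift: "coeff (monom 1 k * u) (k + i) = coeff u i" for k i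
    by (simp add: coeff_monom_mult)
  \<comment> \<open>Multiplication by \<open>monom 1 (N - D)\<close> moves coefficient
    \<open>i\<close> of \<open>u\<close> beyond the length allowed for \<open>u'\<close>.\<close>
  have "coeff u i = 0" if "i > 0" for i
    unfolding shift[of "N - D" i, symmetric] by (rule z) (use that D in linarith)
  then have "u = [:coeff u 0:]" by (intro poly_eqI) (auto simp: coeff_pCons split: nat.split)
  then obtain c where "u = [:c:]" by blast
  then show ?thesis using u(1) by auto
qed

section \<open>Translation between vectors, bivariate forms and polynomials\<close>

definition poly_vec :: "'k::field vec \<Rightarrow> 'k poly" where
  "poly_vec x = Poly (list_of_vec x)"

lemma coeff_poly_vec: "coeff (poly_vec x) i = (if i < dim_vec x then x $ i else 0)"
  by (auto simp: poly_vec_def nth_default_def list_of_vec_index)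

text \<open>The incidence relation of \<open>ann\<close>, read with the form fixed and the sequence
  varying.\<close>

definition recurrent :: "nat \<Rightarrow> nat \<Rightarrow> 'k::field poly \<Rightarrow> 'k vec set" where
  "recurrent N D p = {x \<in> carrier_vec N. p \<in> ann N (poly_vec x) D}"

lemma recurrent_iff:
  assumes "p \<in> polys_below (Suc d)"
  shows "x \<in> recurrent N (Suc d) p \<longleftrightarrow>
    x \<in> carrier_vec N \<and> (\<forall>j. j + d < N \<longrightarrow> (\<Sum>i\<le>d. coeff p i * x $ (i + j)) = 0)"
  unfolding recurrent_def using ann_iff_sums[OF assms]
  by (auto simp: coeff_poly_vec lessThan_Suc_atMost Suc_le_eq intro!: sum.cong)

text \<open>The bound \<open>D \<le> N\<close> matters: for \<open>D = Suc N\<close> the test space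
  is zero and every kernel is the whole space.\<close>

lemma recurrent_eq_imp_smult:
  fixes p r :: "'k::{field,finite} poly"
  assumes "D \<le> N" "p \<in> polys_below D" "p \<noteq> 0" "r \<in> polys_below D"
    and eq: "recurrent N D p = recurrent N D r"
  shows "\<exists>c. r = smult c p"
proof (rule ann_inclusion_imp_smult[OF assms(1-4)])
  fix x :: "'k poly" assume x: "x \<in> polys_below N" and a: "p \<in> ann N x D"
  have "poly_vec (vec N (coeff x)) = x"
    using x by (auto simp: poly_eq_iff coeff_poly_vec polys_below_def)
  moreover have "vec N (coeff x) \<in> recurrent N D p \<longleftrightarrow> vec N (coeff x) \<in> recurrent N D r"
    using eq by simp
  ultimately show "r \<in> ann N x D" using a by (simp add: recurrent_def)
qed

text \<open>For homogeneous \<open>Q\<close> of degree \<open>d\<close> this is \<open>Q\<close> at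
  \<open>Z = 1\<close>. A factor \<open>Z\<close> lowers the degree, so \<open>d\<close> must be
  remembered separately.\<close>

definition hpoly :: "nat \<Rightarrow> 'k::field poly poly \<Rightarrow> 'k poly" where
  "hpoly d Q = Poly (map (hcoeff d Q) [0..<Suc d])"

lemma coeff_hpoly: "coeff (hpoly d Q) i = (if i \<le> d then hcoeff d Q i else 0)"
  by (auto simp: hpoly_def nth_default_def less_Suc_eq_le nth_append simp del: upt_Suc)

lemma hpoly_image: "hpoly d ` (homog (int d) - {0}) = polys_below (Suc d) - {0 :: 'k::field poly}"
proof -
  have nz: "Q = 0" if Q: "Q \<in> homog (int d)" and 0: "hpoly d Q = 0" for Q :: "'k poly poly"
  proof -
    have "coeff (coeff Q j) i = 0" for i j
    proof (rule ccontr)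
      assume a: "coeff (coeff Q j) i \<noteq> 0"
      then have "int (i + j) = int d" using Q unfolding homog_def by blast
      then have "i \<le> d" "d - i = j" by auto
      then have "coeff (hpoly d Q) i \<noteq> 0" using a by (simp add: coeff_hpoly hcoeff_def)
      with 0 show False by simp
    qed
    then show "Q = 0" by (simp add: poly_eq_iff)
  qed
  have below: "hpoly d Q \<in> polys_below (Suc d)" for Q :: "'k poly poly"
    by (auto simp: polys_below_def coeff_hpoly)
  have sur: "p \<in> hpoly d ` (homog (int d) - {0})"
    if p: "p \<in> polys_below (Suc d)" "p \<noteq> 0" for p :: "'k poly"
  proof -
    define Q where "Q = (\<Sum>i\<le>d. monom (monom (coeff p i) i) (d - i))"
    have c: "coeff (coeff Q j) i = (if i + j = d then coeff p i else 0)" for i j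
    proof -
      have "coeff (coeff Q j) i = (\<Sum>l\<le>d. if l = i then (if i + j = d then coeff p i else 0) else 0)"
        unfolding Q_def coeff_sum by (intro sum.cong refl) auto
      then show ?thesis by auto
    qed
    have "Q \<in> homog (int d)" by (simp add: homog_def c flip: of_nat_add)
    moreover have hp: "hpoly d Q = p"
      using p by (auto simp: poly_eq_iff coeff_hpoly hcoeff_def c polys_below_def)
    moreover have "hpoly d 0 = (0 :: 'k poly)" by (simp add: poly_eq_iff coeff_hpoly hcoeff_def)
    with p hp have "Q \<noteq> 0" by blast
    ultimately show ?thesis by blast
  qed
  show ?thesis
  proof (intro subset_antisym subsetI)
    fix p :: "'k poly" assume "p \<in> hpoly d ` (homog (int d) - {0})"
    then obtain Q where "Q \<in> homog (int d)" "Q \<noteq> 0" "p = hpoly d Q" by auto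
    then show "p \<in> polys_below (Suc d) - {0}" using nz below by auto
  qed (use sur in simp)
qed

lemma ker_adj_eq_recurrent:
  assumes n: "n = int N - 1"
  shows "ker_adj n d Q = recurrent N (Suc d) (hpoly d Q)"
proof -
  have b: "hpoly d Q \<in> polys_below (Suc d)" by (auto simp: polys_below_def coeff_hpoly)
  have j: "j < nat (n - int d + 1) \<longleftrightarrow> j + d < N" for j using n by auto
  have s: "(\<Sum>i\<le>d. coeff (hpoly d Q) i * f i) = (\<Sum>i\<le>d. hcoeff d Q i * f i)" for f
    by (intro sum.cong refl) (simp add: coeff_hpoly)
  have x: "seqs n = carrier_vec N" by (simp add: n seqs_def)
  show ?thesis
    unfolding set_eq_iff recurrent_iff[OF b] s ker_adj_def x mult_adj_def
    by (simp add: vec_eq_iff j)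
qed

lemma kernels_eq:
  assumes "n = int N - 1"
  shows "kernels n d = recurrent N (Suc d) ` (polys_below (Suc d) - {0})"
  unfolding hpoly_image[symmetric] image_image kernels_def ker_adj_eq_recurrent[OF assms] by blast

lemma rec_seqs_iff:
  assumes n: "n = int N - 1"
  shows "x \<in> rec_seqs n m \<longleftrightarrow> (\<exists>p\<in>polys_below (Suc m) - {0}. x \<in> recurrent N (Suc m) p)"
proof -
  have j: "int j \<le> n - int m \<longleftrightarrow> j + m < N" for j using n by auto
  have x: "seqs n = carrier_vec N" using n by (simp add: seqs_def)
  show ?thesis
  proof
    assume "x \<in> rec_seqs n m"
    then have "x \<in> carrier_vec N" "\<exists>a. (\<exists>i\<le>m. a i \<noteq> 0) \<and>
        (\<forall>j. j + m < N \<longrightarrow> (\<Sum>i\<le>m. a i * x $ (i + j)) = 0)"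
      unfolding rec_seqs_def j x by simp_all
    then obtain a i where a: "x \<in> carrier_vec N" "i \<le> m" "a i \<noteq> 0"
      "\<forall>j. j + m < N \<longrightarrow> (\<Sum>i\<le>m. a i * x $ (i + j)) = 0"
      by auto
    define p where "p = Poly (map a [0..<Suc m])"
    have c: "coeff p i = (if i \<le> m then a i else 0)" for i
      by (auto simp: p_def nth_default_def less_Suc_eq_le nth_append simp del: upt_Suc)
    have p: "p \<in> polys_below (Suc m)" by (auto simp: polys_below_def c)
    have "p \<noteq> 0" using a c[of i] by auto
    moreover have "x \<in> recurrent N (Suc m) p" using a by (simp add: recurrent_iff[OF p] c)
    ultimately show "\<exists>p\<in>polys_below (Suc m) - {0}. x \<in> recurrent N (Suc m) p" using p by blast
  next
    assume "\<exists>p\<in>polys_below (Suc m) - {0}. x \<in> recurrent N (Suc m) p"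
    then obtain p where p: "p \<in> polys_below (Suc m)" "p \<noteq> 0" "x \<in> recurrent N (Suc m) p" by blast
    have "\<exists>i\<le>m. coeff p i \<noteq> 0" using p(1,2) by (auto simp: polys_below_def poly_eq_iff not_less_eq_eq[symmetric])
    moreover have "x \<in> carrier_vec N" "\<forall>j. j + m < N \<longrightarrow> (\<Sum>i\<le>m. coeff p i * x $ (i + j)) = 0"
      using p(3) by (simp_all add: recurrent_iff[OF p(1)])
    ultimately show "x \<in> rec_seqs n m"
      unfolding rec_seqs_def j x by (intro CollectI conjI exI[of _ "coeff p"])
  qed
qed

text \<open>Nonzero annihilators of \<open>x\<close> are grouped by their kernel; each group is a
  line without its origin and has q - 1 elements.\<close>

lemma sum_indicator_kernels:
  fixes x :: "'k::{field,finite} vec"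
  assumes n: "n = int N - 1" and d: "Suc d \<le> N" and x: "x \<in> carrier_vec N"
  shows "(int CARD('k) - 1) * (\<Sum>K\<in>kernels n d. indicator K x) =
    int (card (ann N (poly_vec x) (Suc d))) - 1"
proof -
  let ?A = "ann N (poly_vec x) (Suc d) - {0}" and ?K = "recurrent N (Suc d) :: 'k poly \<Rightarrow> _"
  define T where "T = {K \<in> kernels n d. x \<in> K}"
  have fin: "finite T" by (simp add: T_def finite_kernels)
  have T: "T = ?K ` ?A"
    unfolding T_def kernels_eq[OF n] using x by (auto simp: recurrent_def ann_def)
  have "card {r \<in> ?A. ?K r = K} = CARD('k) - 1" if K: "K \<in> T" for K
  proof -
    obtain p where p: "p \<in> ?A" "K = ?K p" using K T by auto
    have pb: "p \<in> polys_below (Suc d)" "p \<noteq> 0" using p by (auto simp: ann_def)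
    have sm: "?K (smult c p) = ?K p" if "c \<noteq> 0" for c
    proof -
      have "smult c p \<in> ann N y (Suc d) \<longleftrightarrow> p \<in> ann N y (Suc d)" for y
        using lin_closedD(3)[OF lin_closed_ann, of p N y "Suc d" c]
          lin_closedD(3)[OF lin_closed_ann, of "smult c p" N y "Suc d" "inverse c"] that by auto
      then show ?thesis by (simp add: recurrent_def)
    qed
    have "{r \<in> ?A. ?K r = K} = (\<lambda>c. smult c p) ` (UNIV - {0})"
    proof (intro equalityI subsetI)
      fix r assume "r \<in> {r \<in> ?A. ?K r = K}"
      then have r: "r \<in> polys_below (Suc d)" "r \<noteq> 0" "?K p = ?K r" using p by (auto simp: ann_def)
      from recurrent_eq_imp_smult[OF d pb r(1,3)] r(2)
      show "r \<in> (\<lambda>c. smult c p) ` (UNIV - {0})" by auto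
    next
      fix r assume "r \<in> (\<lambda>c. smult c p) ` (UNIV - {0})"
      then obtain c where "r = smult c p" "c \<noteq> 0" by auto
      then show "r \<in> {r \<in> ?A. ?K r = K}"
        using p sm lin_closedD(3)[OF lin_closed_ann] by auto
    qed
    moreover have "inj_on (\<lambda>c. smult c p) (UNIV - {0})"
      using pb(2) by (auto simp: inj_on_def poly_eq_iff)
    ultimately show ?thesis by (simp add: card_image card_Diff_singleton)
  qed
  then have "card ?A = (CARD('k) - 1) * card T"
    using sum.group[of ?A T ?K "\<lambda>_. 1::nat"] T fin finite_ann[of N "poly_vec x" "Suc d"]
    by (simp add: mult.commute)
  moreover have "card ?A = card (ann N (poly_vec x) (Suc d)) - 1"
    by (simp add: card_Diff_singleton lin_closedD(1)[OF lin_closed_ann])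
  moreover have "(\<Sum>K\<in>kernels n d. indicator K x) = int (card T)"
    by (simp add: indicator_def T_def sum.If_cases Int_def finite_kernels)
  ultimately show ?thesis
    using card_ann_pos[of N "poly_vec x" "Suc d"] card_field_gt_1[where 'k = 'k]
    by (metis One_nat_def Suc_leI less_imp_le_nat of_nat_1 of_nat_diff of_nat_mult)
qed

theorem proposition2:
  fixes m :: nat and n :: int and x :: "'k::{field,finite} vec"
  assumes "2 * int m \<le> n + 1"
    and "x \<in> seqs n"
  shows "(indicator (rec_seqs n m) x :: int) =
    (\<Sum>K\<in>kernels n m. indicator K x)
    - int CARD('k) * (if m = 0 then 0 else (\<Sum>K\<in>kernels n (m - 1). indicator K x))"
proof -
  define N where "N = nat (n + 1)"
  have n: "n = int N - 1" and mN: "2 * m \<le> N" using assms(1) by (auto simp: N_def)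
  have x: "x \<in> carrier_vec N" using assms(2) by (simp add: seqs_def N_def)
  show ?thesis
  proof (cases m)
    case 0
    \<comment> \<open>Degree 0 is done directly: if \<open>N = 0\<close>, the bound
      \<open>Suc m \<le> N\<close> of the count fails. A nonzero constant has only the zero sequence
      in its kernel.\<close>
    have K: "recurrent N (Suc 0) p = {0\<^sub>v N}" if "p \<in> polys_below (Suc 0) - {0 :: 'k poly}" for p
    proof -
      have "coeff p 0 \<noteq> 0"
        using that by (auto simp: polys_below_def poly_eq_iff) (metis Suc_leI neq0_conv)
      then show ?thesis using that by (auto simp: recurrent_iff)
    qed
    have 1: "1 \<in> polys_below (Suc 0) - {0 :: 'k poly}" by (auto simp: polys_below_def coeff_1)
    have "kernels n 0 = (\<lambda>_. {0\<^sub>v N :: 'k vec}) ` (polys_below (Suc 0) - {0 :: 'k poly})"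
      unfolding kernels_eq[OF n] by (rule image_cong[OF refl K])
    with 1 have "kernels n 0 = {{0\<^sub>v N :: 'k vec}}" by blast
    moreover have "rec_seqs n 0 = {0\<^sub>v N :: 'k vec}"
      using 1 K unfolding set_eq_iff rec_seqs_iff[OF n] by blast
    ultimately show ?thesis using 0 by simp
  next
    case (Suc d)
    let ?c = "\<lambda>D. card (ann N (poly_vec x) D)" and ?q = "int CARD('k)"
    have "x \<in> rec_seqs n m \<longleftrightarrow> (\<exists>p\<in>ann N (poly_vec x) (Suc m). p \<noteq> 0)"
      unfolding rec_seqs_iff[OF n] using x by (auto simp: recurrent_def ann_def)
    also have "\<dots> \<longleftrightarrow> ?c (Suc m) > 1"
    proof -
      have "?c (Suc m) \<le> 1 \<longleftrightarrow> ann N (poly_vec x) (Suc m) \<subseteq> {0}"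
        using lin_closedD(1)[OF lin_closed_ann, of N "poly_vec x" "Suc m"]
          finite_ann[of N "poly_vec x" "Suc m"] by (auto simp: card_le_Suc0_iff_eq)
      then show ?thesis by (auto simp: not_le[symmetric])
    qed
    finally have rec: "x \<in> rec_seqs n m \<longleftrightarrow> ?c (Suc m) > 1" .
    \<comment> \<open>Scaling by the nonzero q - 1 turns both sums into cardinalities; degrees
      \<open>m\<close> and \<open>d = m - 1\<close> have indices \<open>Suc m\<close> and
      \<open>m\<close>.\<close>
    have "(?q - 1) * ((\<Sum>K\<in>kernels n m. indicator K x) - ?q * (\<Sum>K\<in>kernels n d. indicator K x)) =
        (?q - 1) * (\<Sum>K\<in>kernels n m. indicator K x) - ?q * ((?q - 1) * (\<Sum>K\<in>kernels n d. indicator K x))"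
      by (simp add: algebra_simps)
    also have "\<dots> = (int (?c (Suc m)) - 1) - ?q * (int (?c m) - 1)"
      using sum_indicator_kernels[OF n _ x, of m] sum_indicator_kernels[OF n _ x, of d] Suc mN by simp
    also have "\<dots> = (?q - 1) * indicator (rec_seqs n m) x"
    proof (cases "?c (Suc m) > 1")
      case True
      with card_ann_Suc[OF mN True] rec show ?thesis by (simp add: algebra_simps)
    next
      case False
      moreover have "?c m \<le> ?c (Suc m)" by (rule card_mono[OF finite_ann ann_Suc_mono])
      moreover have "?c m > 0" by (rule card_ann_pos)
      ultimately have "?c m = 1" "?c (Suc m) = 1" by linarith+
      with rec show ?thesis by simp
    qed
    finally show ?thesis using card_field_gt_1[where 'k = 'k] Suc by simp
  qed
qed

end
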